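(* Let $n\ge 1$ and let $A=zz^T+\sigma\Delta$ for some $z\in\{\pm1\}^n$, with $\sigma=c\sqrt n$, $\Delta=\Delta^T\in\mathbb{R}^{n\times n}$, $\operatorname{diag}(\Delta)=0$, $\|\Delta\|\le\gamma\sqrt n$ and $\|\Delta z\|_\infty\le\gamma\sqrt{n\log n}$, for some $\gamma,c\ge0$. If $$\gamma c<\frac{1}{9+\sqrt{\log n}+4\sqrt{\gamma cn}},$$ then all second-order critical points $Q\in\mathbb{R}^{n\times2}$ of $$\max_{Q\in\mathbb{R}^{n\times2}}\operatorname{Tr}(Q^TAQ)\quad\text{s.t. }\|Q_{i:}\|_2^2=1,\ 1\le i\le n,$$ are global optima of this problem of rank $1$ such that $QQ^T=zz^T$. Moreover, there exists a constant $k>0$ (independent of $n,\gamma,c,z,\Delta$) such that, if $\gamma c\le kn^{-1/3}$, then the displayed condition on $\gamma c$ holds, and hence so does the conclusion.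
   Context: $\|\cdot\|$ is the operator norm (largest singular value); $Q_{i:}$ denotes the $i$th row of $Q$. The operator $\mathrm{ddiag}$ maps a square matrix to the diagonal matrix obtained by setting all off-diagonal entries to zero; $\circ$ is the entrywise (Hadamard) product. A second-order critical point of $\max\{\operatorname{Tr}(Q^TAQ): Q\in\mathbb{R}^{n\times 2},\ \|Q_{i:}\|_2=1\ \forall i\}$ is a feasible $Q$ satisfying the first-order condition $(\mathrm{ddiag}(AQQ^T)-A)Q=0$ and the second-order condition $\mathrm{ddiag}(AQQ^T)-A\circ(QQ^T)\succeq 0$. *)

theory Defs
  imports "HOL-Analysis.Analysis"
begin

definition outer_prod :: "real ^ 'n \<Rightarrow> real ^ 'n ^ 'n" where
  "outer_prod z = (\<chi> i j. z $ i * z $ j)"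

definition ddiag :: "real ^ 'n ^ 'n \<Rightarrow> real ^ 'n ^ 'n" where
  "ddiag M = (\<chi> i j. if i = j then M $ i $ j else 0)"

definition hadamard :: "real ^ 'n ^ 'n \<Rightarrow> real ^ 'n ^ 'n \<Rightarrow> real ^ 'n ^ 'n" where
  "hadamard M N = (\<chi> i j. M $ i $ j * N $ i $ j)"

definition psd :: "real ^ 'n ^ 'n \<Rightarrow> bool" where
  "psd M \<longleftrightarrow> transpose M = M \<and> (\<forall>x. 0 \<le> x \<bullet> (M *v x))"

definition feasible :: "real ^ 2 ^ 'n \<Rightarrow> bool" where
  "feasible Q \<longleftrightarrow> (\<forall>i. norm (row i Q) = 1)"

definition objective :: "real ^ 'n ^ 'n \<Rightarrow> real ^ 2 ^ 'n \<Rightarrow> real" where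
  "objective A Q = trace (transpose Q ** A ** Q)"

definition global_optimum :: "real ^ 'n ^ 'n \<Rightarrow> real ^ 2 ^ 'n \<Rightarrow> bool" where
  "global_optimum A Q \<longleftrightarrow> is_arg_max (objective A) feasible Q"

definition second_order_critical :: "real ^ 'n ^ 'n \<Rightarrow> real ^ 2 ^ 'n \<Rightarrow> bool" where
  "second_order_critical A Q \<longleftrightarrow>
     feasible Q \<and>
     (ddiag (A ** Q ** transpose Q) - A) ** Q = 0 \<and>
     psd (ddiag (A ** Q ** transpose Q) - hadamard A (Q ** transpose Q))"

text \<open>The dimension \<open>n\<close> is \<open>CARD('n)\<close>. The operator norm of a matrix is the \<open>onorm\<close> of
  the induced map on Euclidean space.\<close>

definition signal_plus_noise ::
    "real ^ 'n \<Rightarrow> real ^ 'n ^ 'n \<Rightarrow> real \<Rightarrow> real \<Rightarrow> real ^ 'n ^ 'n \<Rightarrow> bool" where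
  "signal_plus_noise z \<Delta> \<gamma> c A \<longleftrightarrow>
     0 \<le> \<gamma> \<and> 0 \<le> c \<and>
     (\<forall>i. z $ i \<in> {-1, 1}) \<and>
     transpose \<Delta> = \<Delta> \<and>
     (\<forall>i. \<Delta> $ i $ i = 0) \<and>
     onorm ((*v) \<Delta>) \<le> \<gamma> * sqrt (real CARD('n)) \<and>
     infnorm (\<Delta> *v z) \<le> \<gamma> * sqrt (real CARD('n) * ln (real CARD('n))) \<and>
     (let \<sigma> = c * sqrt (real CARD('n)) in A = outer_prod z + \<sigma> *\<^sub>R \<Delta>)"

definition noise_condition :: "nat \<Rightarrow> real \<Rightarrow> real \<Rightarrow> bool" where
  "noise_condition n \<gamma> c \<longleftrightarrow>
     \<gamma> * c < 1 / (9 + sqrt (ln (real n)) + 4 * sqrt (\<gamma> * c * real n))"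

definition critical_points_recover :: "real ^ 'n ^ 'n \<Rightarrow> real ^ 'n \<Rightarrow> bool" where
  "critical_points_recover A z \<longleftrightarrow>
     (\<forall>Q. second_order_critical A Q \<longrightarrow>
        global_optimum A Q \<and> rank Q = 1 \<and> Q ** transpose Q = outer_prod z)"

end

theory Submission
  imports Defs
begin

text \<open>
  Write \<open>E = \<sigma>\<Delta>\<close> and \<open>d = \<gamma>c\<close>, so that \<open>\<parallel>E\<parallel> \<le> dn\<close>. Averaging the second-order condition gives
  \<open>S = \<parallel>Q\<^sup>Tz\<parallel>\<close> of order \<open>n\<close>. Rotate \<open>Q\<close> so that its columns \<open>u\<close>, \<open>v\<close> satisfy \<open>z \<bullet> u = S\<close>
  and \<open>z \<bullet> v = 0\<close>. The first-order condition then reads \<open>s\<^sub>i u\<^sub>i = S z\<^sub>i + (Eu)\<^sub>i\<close>,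
  \<open>s\<^sub>i v\<^sub>i = (Ev)\<^sub>i\<close>, and the diagonal of the second-order condition gives \<open>s\<^sub>i > 0\<close>. So each row
  is the normalization of a perturbation of \<open>(S z\<^sub>i, 0)\<close>, which forces \<open>\<parallel>u - z\<parallel>\<^sup>2 = O(d\<^sup>2n)\<close> and
  bootstraps to \<open>n - S = O(d\<^sup>2n)\<close>. Splitting \<open>Eu = Ez + E(u - z)\<close> bounds \<open>(Eu)\<^sub>i\<close> uniformly, hence
  \<open>s\<^sub>i > dn \<ge> \<parallel>E\<parallel>\<close> for all \<open>i\<close>; since \<open>Ev = s \<circ> v\<close>, this is only possible for \<open>v = 0\<close>.
\<close>

section \<open>The critical-point conditions in terms of the two columns\<close>

definition pmul :: "real ^ 'n \<Rightarrow> real ^ 'n \<Rightarrow> real ^ 'n" where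
  "pmul x y = (\<chi> i. x $ i * y $ i)"

lemma pmul_nth [simp]: "pmul x y $ i = x $ i * y $ i"
  by (simp add: pmul_def)

lemma outer_prod_mult_vec: "outer_prod z *v x = (z \<bullet> x) *\<^sub>R z"
  by (simp add: outer_prod_def matrix_vector_mult_def vec_eq_iff inner_vec_def
      sum_distrib_left sum_distrib_right mult_ac)

lemma norm_vec_power2: "(norm x)\<^sup>2 = (\<Sum>i\<in>UNIV. (x $ i)\<^sup>2)" for x :: "real ^ 'n"
  unfolding power2_norm_eq_inner by (simp add: inner_vec_def power2_eq_square)

lemma norm_row_power2: "(norm (row i Q))\<^sup>2 = (column 1 Q $ i)\<^sup>2 + (column 2 Q $ i)\<^sup>2"
  for Q :: "real ^ 2 ^ 'n"
  by (simp add: norm_vec_power2 row_def column_def sum_2)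

lemma gram_nth:
  "(Q ** transpose Q) $ i $ j = column 1 Q $ i * column 1 Q $ j + column 2 Q $ i * column 2 Q $ j"
  for Q :: "real ^ 2 ^ 'n"
  by (simp add: matrix_matrix_mult_def transpose_def column_def sum_2)

lemma objective_columns:
  "objective A Q = column 1 Q \<bullet> (A *v column 1 Q) + column 2 Q \<bullet> (A *v column 2 Q)"
proof -
  have "objective A Q = (\<Sum>k\<in>UNIV. column k Q \<bullet> (A *v column k Q))"
    unfolding objective_def matrix_mul_assoc[symmetric]
    by (simp add: trace_def matrix_matrix_mult_def transpose_def matrix_vector_mult_def
        inner_vec_def column_def)
  then show ?thesis by (simp add: sum_2)
qed

lemma feasible_columns:
  fixes Q :: "real ^ 2 ^ 'n"
  assumes "feasible Q"
  shows "(column 1 Q $ i)\<^sup>2 + (column 2 Q $ i)\<^sup>2 = 1"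
  using assms norm_row_power2[of i Q] by (simp add: feasible_def)

text \<open>The diagonal entries of \<open>A ** Q ** transpose Q\<close> are the Lagrange
  multipliers of the unit-row constraints; one multiplier vector serves both columns.\<close>

lemma second_order_critical_first_order:
  fixes Q :: "real ^ 2 ^ 'n"
  assumes "second_order_critical A Q"
  shows "A *v column k Q = pmul (\<chi> i. (A ** Q ** transpose Q) $ i $ i) (column k Q)"
proof -
  have "(ddiag (A ** Q ** transpose Q) - A) ** Q = 0"
    using assms by (simp add: second_order_critical_def)
  then have "((ddiag (A ** Q ** transpose Q) - A) ** Q) $ i $ k = 0" for i
    by simp
  moreover have "((ddiag M - A) ** Q) $ i $ k = M $ i $ i * Q $ i $ k - (A *v column k Q) $ i" for i M
    by (simp add: matrix_matrix_mult_def ddiag_def matrix_vector_mult_def column_def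
        left_diff_distrib sum_subtractf if_distrib[of "\<lambda>x. x * _"] cong: if_cong)
  ultimately show ?thesis
    by (simp add: vec_eq_iff column_def)
qed

text \<open>Each entry of \<open>Q ** transpose Q\<close> is a sum of one product per column, so the
  form of the Hadamard product splits into one form of \<open>A\<close> per column.\<close>

lemma second_order_critical_quadratic_form:
  fixes Q :: "real ^ 2 ^ 'n"
  assumes "second_order_critical A Q"
  shows "pmul (column 1 Q) x \<bullet> (A *v pmul (column 1 Q) x)
           + pmul (column 2 Q) x \<bullet> (A *v pmul (column 2 Q) x)
         \<le> (\<Sum>i\<in>UNIV. (A ** Q ** transpose Q) $ i $ i * (x $ i)\<^sup>2)"
proof -
  define s where "s i = (A ** Q ** transpose Q) $ i $ i" for i
  have "0 \<le> x \<bullet> ((ddiag (A ** Q ** transpose Q) - hadamard A (Q ** transpose Q)) *v x)"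
    using assms by (simp add: second_order_critical_def psd_def)
  also have "\<dots> = (\<Sum>i\<in>UNIV. s i * (x $ i)\<^sup>2) - x \<bullet> (hadamard A (Q ** transpose Q) *v x)"
  proof -
    have "(ddiag (A ** Q ** transpose Q) *v x) $ i = s i * x $ i" for i
      by (simp add: s_def ddiag_def matrix_vector_mult_def if_distrib[of "\<lambda>x. x * _"] cong: if_cong)
    then show ?thesis
      by (simp add: matrix_vector_mult_diff_rdistrib inner_diff_right inner_vec_def power2_eq_square
          right_diff_distrib sum_subtractf mult_ac)
  qed
  also have "x \<bullet> (hadamard A (Q ** transpose Q) *v x)
     = pmul (column 1 Q) x \<bullet> (A *v pmul (column 1 Q) x)
           + pmul (column 2 Q) x \<bullet> (A *v pmul (column 2 Q) x)"
    by (simp add: hadamard_def gram_nth inner_vec_def matrix_vector_mult_def sum_distrib_left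
        algebra_simps flip: sum.distrib)
  finally show ?thesis by (simp add: s_def)
qed

text \<open>The prescribed inner products make the squared distance of each row from a signed copy
  of one fixed row vanish, so the row space is a line.\<close>

lemma rank_gram_outer_prod:
  fixes Q :: "real ^ 2 ^ 'n"
  assumes z: "\<And>i. (z $ i)\<^sup>2 = 1" and gram: "Q ** transpose Q = outer_prod z"
  shows "rank Q = 1"
proof -
  have dot: "row i Q \<bullet> row j Q = z $ i * z $ j" for i j
  proof -
    have "(Q ** transpose Q) $ i $ j = row i Q \<bullet> row j Q"
      by (simp add: matrix_matrix_mult_def transpose_def row_def inner_vec_def)
    then show ?thesis by (simp add: gram outer_prod_def)
  qed
  define b where "b = row undefined Q"
  have row: "row i Q = (z $ i * z $ undefined) *\<^sub>R b" for i
  proof -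
    have "(norm (row i Q - (z $ i * z $ undefined) *\<^sub>R b))\<^sup>2 = 0"
      unfolding power2_norm_eq_inner b_def
      using z[of i] z[of undefined]
      by (simp add: inner_diff_left inner_diff_right dot algebra_simps power2_eq_square)
    then show ?thesis by simp
  qed
  have "b \<in> rows Q" by (auto simp: b_def rows_def)
  moreover have "rows Q \<subseteq> span {b}"
    by (auto simp: rows_def row span_base span_scale)
  ultimately have "span (rows Q) = span {b}"
    by (metis empty_subsetI insert_subset span_mono span_span subset_antisym span_superset)
  moreover have "b \<noteq> 0"
    using dot[of undefined undefined] z[of undefined] by (auto simp: b_def power2_eq_square)
  ultimately have "dim (rows Q) = 1"
    by (metis dim_span dim_singleton)
  then show ?thesis by (simp add: row_rank_def)
qed

section \<open>Scalar estimates: normalization error and size of the noise level\<close>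

text \<open>The unit vector \<open>(u, v)\<close> is the normalization of a perturbation of \<open>(S z, 0)\<close>, and
  normalizing at most doubles the relative error.\<close>
lemma normalization_error:
  fixes s u v S z w1 w2 :: real
  assumes s: "s > 0" and S: "S > 0" and unit: "u\<^sup>2 + v\<^sup>2 = 1" and z: "z\<^sup>2 = 1"
    and w1: "s * u = S * z + w1" and w2: "s * v = w2"
  shows "S\<^sup>2 * ((u - z)\<^sup>2 + v\<^sup>2) \<le> 4 * (w1\<^sup>2 + w2\<^sup>2)"
proof -
  \<comment> \<open>The cosine of the angle between \<open>(u, v)\<close> and \<open>(z, 0)\<close>;
    the law of cosines gives both squared distances.\<close>
  define c where "c = z * u"
  have c2: "c\<^sup>2 \<le> 1"
    using unit z by (simp add: c_def power_mult_distrib) (metis le_add_same_cancel1 zero_le_power2)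
  then have c1: "c \<le> 1" "-1 \<le> c"
    by (simp_all add: abs_square_le_1 abs_le_iff)
  have "w1\<^sup>2 + w2\<^sup>2 = (s * u - S * z)\<^sup>2 + (s * v)\<^sup>2"
    using w1 w2 by simp
  also have "\<dots> = s\<^sup>2 * (u\<^sup>2 + v\<^sup>2) + S\<^sup>2 * z\<^sup>2 - 2 * s * S * c"
    unfolding c_def by algebra
  finally have w: "w1\<^sup>2 + w2\<^sup>2 = s\<^sup>2 + S\<^sup>2 - 2 * s * S * c"
    by (simp add: unit z)
  have "(u - z)\<^sup>2 + v\<^sup>2 = (u\<^sup>2 + v\<^sup>2) + z\<^sup>2 - 2 * c"
    unfolding c_def by algebra
  then have d: "(u - z)\<^sup>2 + v\<^sup>2 = 2 - 2 * c"
    by (simp add: unit z)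
  have "0 \<le> 4 * (s\<^sup>2 + S\<^sup>2 - 2 * s * S * c) - S\<^sup>2 * (2 - 2 * c)"
  \<comment> \<open>In the first case completing the square in \<open>s\<close> leaves a nonnegative
    remainder; in the second the cross term is itself nonnegative.\<close>
  proof (cases "c \<ge> - 1 / 2")
    case True
    have "4 * (s\<^sup>2 + S\<^sup>2 - 2 * s * S * c) - S\<^sup>2 * (2 - 2 * c)
        = 4 * (s - S * c)\<^sup>2 + 2 * S\<^sup>2 * ((1 - c) * (1 + 2 * c))"
      by algebra
    with True c1 show ?thesis by simp
  next
    case False
    have "4 * (s\<^sup>2 + S\<^sup>2 - 2 * s * S * c) - S\<^sup>2 * (2 - 2 * c)
        = 4 * s\<^sup>2 + 2 * S\<^sup>2 * (1 + c) + 8 * (s * S) * (- c)"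
      by algebra
    moreover have "0 \<le> 8 * (s * S) * (- c)"
      using False s S by (intro mult_nonneg_nonneg) auto
    moreover have "0 \<le> 4 * s\<^sup>2 + 2 * S\<^sup>2 * (1 + c)"
      using c1 by simp
    ultimately show ?thesis by linarith
  qed
  then show ?thesis by (simp add: w d)
qed

text \<open>With \<open>t\<close> the cube root of \<open>n\<close>, the three terms of the
  denominator are at most \<open>9 * t\<close>, \<open>2 * t\<close> and \<open>t\<close>, and the
  constant 1/16 gives \<open>d * (12 * t) \<le> 3 / 4\<close>.\<close>

lemma noise_condition_of_le_powr:
  assumes n: "n \<ge> 1" and d: "0 \<le> \<gamma>" "0 \<le> c" "\<gamma> * c \<le> 1 / 16 * real n powr (- 1 / 3)"
  shows "noise_condition n \<gamma> c"
proof -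
  define d where "d = \<gamma> * c"
  define t where "t = real n powr (1 / 3)"
  have t1: "t \<ge> 1" using n by (simp add: t_def ge_one_powr_ge_zero)
  have tn: "t ^ 3 = real n"
    using n by (simp add: t_def powr_powr flip: powr_realpow)
  have d0: "0 \<le> d" using d by (simp add: d_def)
  have "d \<le> 1 / 16 / t"
    using d by (simp add: d_def t_def powr_minus divide_simps)
  then have dt: "d * t \<le> 1 / 16"
    using t1 by (simp add: field_simps)
  have "ln (real n) = 3 * ln t"
    using t1 by (simp add: ln_realpow flip: tn)
  also have "\<dots> \<le> 3 * t" using t1 ln_le_minus_one[of t] by simp
  also have "\<dots> \<le> (2 * t)\<^sup>2"
  proof -
    have "t * 1 \<le> t * t" using t1 by (intro mult_left_mono) auto
    then show ?thesis using t1 by (simp add: power2_eq_square)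
  qed
  finally have "sqrt (ln (real n)) \<le> 2 * t"
    using t1 by (intro real_le_lsqrt) auto
  then have 1: "d * sqrt (ln (real n)) \<le> d * (2 * t)"
    by (intro mult_left_mono d0)
  have "d * real n = (d * t) * t\<^sup>2"
    by (simp add: power2_eq_square power3_eq_cube flip: tn)
  also have "\<dots> \<le> 1 / 16 * t\<^sup>2" using dt by (intro mult_right_mono) auto
  also have "\<dots> = (t / 4)\<^sup>2" by (simp add: power_divide)
  finally have "sqrt (d * real n) \<le> t / 4"
    using t1 by (intro real_le_lsqrt) auto
  then have 2: "d * sqrt (d * real n) \<le> d * (t / 4)"
    by (intro mult_left_mono d0)
  have 3: "d * 1 \<le> d * t" using t1 by (intro mult_left_mono d0)
  have "d * (9 + sqrt (ln (real n)) + 4 * sqrt (d * real n)) < 1"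
    using 1 2 3 dt by (simp add: algebra_simps)
  moreover have "0 < 9 + sqrt (ln (real n)) + 4 * sqrt (d * real n)"
    using n d0 by (intro add_pos_nonneg) auto
  ultimately show ?thesis
    by (simp add: noise_condition_def d_def pos_less_divide_eq)
qed


section \<open>Quadratic forms of signal plus noise and the correlation with
  \<open>z\<close>\<close>

lemma signal_plus_noise_mult_vec:
  "(outer_prod z + E) *v x = (z \<bullet> x) *\<^sub>R z + E *v x"
  by (simp add: matrix_vector_mult_add_rdistrib outer_prod_mult_vec)

lemma signal_plus_noise_quadratic_form:
  "x \<bullet> ((outer_prod z + E) *v x) = (z \<bullet> x)\<^sup>2 + x \<bullet> (E *v x)"
  by (simp add: signal_plus_noise_mult_vec inner_add_right power2_eq_square inner_commute)

lemma quadratic_form_le: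
  fixes E :: "real ^ 'n ^ 'n"
  assumes "\<And>x. norm (E *v x) \<le> e * norm x"
  shows "\<bar>x \<bullet> (E *v x)\<bar> \<le> e * (norm x)\<^sup>2"
proof -
  have "\<bar>x \<bullet> (E *v x)\<bar> \<le> norm x * norm (E *v x)"
    by (rule Cauchy_Schwarz_ineq2)
  also have "\<dots> \<le> norm x * (e * norm x)"
    by (intro mult_left_mono assms) auto
  finally show ?thesis by (simp add: power2_eq_square mult_ac)
qed

text \<open>The second-order condition is averaged over the two test vectors \<open>z \<circ> p\<close> and \<open>z \<circ> q\<close>;
  this amounts to pairing it with \<open>QQ\<^sup>T \<circ> zz\<^sup>T\<close>, so that the signal contributes
  \<open>\<parallel>QQ\<^sup>T\<parallel>\<^sub>F\<^sup>2\<close>, which is at least \<open>n\<^sup>2/2\<close> because \<open>QQ\<^sup>T\<close> has trace \<open>n\<close> and rank at most 2.\<close>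
lemma correlation_lower_bound:
  fixes p q s z :: "real ^ 'n" and E :: "real ^ 'n ^ 'n"
  defines "A \<equiv> outer_prod z + E" and "n \<equiv> real CARD('n)"
  assumes unit: "\<And>i. (p $ i)\<^sup>2 + (q $ i)\<^sup>2 = 1" and z: "\<And>i. (z $ i)\<^sup>2 = 1"
    and E: "\<And>x. norm (E *v x) \<le> e * norm x"
    and fo: "A *v p = pmul s p" "A *v q = pmul s q"
    and so: "\<And>x. pmul p x \<bullet> (A *v pmul p x) + pmul q x \<bullet> (A *v pmul q x)
               \<le> (\<Sum>i\<in>UNIV. s $ i * (x $ i)\<^sup>2)"
  shows "(z \<bullet> p)\<^sup>2 + (z \<bullet> q)\<^sup>2 \<ge> n\<^sup>2 / 2 - 2 * e * n"
proof -
  \<comment> \<open>Products of the two test vectors with \<open>p\<close> and \<open>q\<close>; the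
    mixed product \<open>R\<close> arises from both.\<close>
  define P where "P = pmul p (pmul z p)"
  define R where "R = pmul q (pmul z p)"
  define T where "T = pmul q (pmul z q)"
  have R': "pmul p (pmul z q) = R" by (simp add: R_def vec_eq_iff mult_ac)
  have pq: "(norm p)\<^sup>2 + (norm q)\<^sup>2 = n"
    by (simp add: norm_vec_power2 unit n_def flip: sum.distrib)
  have zPT: "z \<bullet> P + z \<bullet> T = n"
  proof -
    have "z \<bullet> P + z \<bullet> T = (\<Sum>i\<in>UNIV. (z $ i)\<^sup>2 * ((p $ i)\<^sup>2 + (q $ i)\<^sup>2))"
      by (simp add: P_def T_def inner_vec_def power2_eq_square algebra_simps flip: sum.distrib)
    then show ?thesis by (simp add: z unit n_def)
  qed
  have PRT: "(norm P)\<^sup>2 + 2 * (norm R)\<^sup>2 + (norm T)\<^sup>2 = n"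
  proof -
    have "(norm P)\<^sup>2 + 2 * (norm R)\<^sup>2 + (norm T)\<^sup>2
        = (\<Sum>i\<in>UNIV. (z $ i)\<^sup>2 * ((p $ i)\<^sup>2 + (q $ i)\<^sup>2)\<^sup>2)"
      unfolding norm_vec_power2
      by (simp add: P_def R_def T_def power2_eq_square algebra_simps
          sum_distrib_left flip: sum.distrib)
    then show ?thesis by (simp add: z unit n_def)
  qed
  \<comment> \<open>The multipliers sum to the objective value, which ties the second-order
    condition to the correlations.\<close>
  have "(\<Sum>i\<in>UNIV. s $ i) = (\<Sum>i\<in>UNIV. s $ i * ((p $ i)\<^sup>2 + (q $ i)\<^sup>2))"
    by (simp add: unit)
  also have "\<dots> = p \<bullet> pmul s p + q \<bullet> pmul s q"
    by (simp add: inner_vec_def power2_eq_square algebra_simps flip: sum.distrib)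
  also have "\<dots> = (z \<bullet> p)\<^sup>2 + (z \<bullet> q)\<^sup>2 + (p \<bullet> (E *v p) + q \<bullet> (E *v q))"
    by (simp add: signal_plus_noise_quadratic_form A_def flip: fo)
  finally have 1: "(\<Sum>i\<in>UNIV. s $ i) = \<dots>" .
  have "P \<bullet> (A *v P) + R \<bullet> (A *v R) + (R \<bullet> (A *v R) + T \<bullet> (A *v T))
      \<le> (\<Sum>i\<in>UNIV. s $ i * (pmul z p $ i)\<^sup>2) + (\<Sum>i\<in>UNIV. s $ i * (pmul z q $ i)\<^sup>2)"
    using so[of "pmul z p"] so[of "pmul z q"] unfolding R' by (simp add: P_def R_def T_def)
  also have "\<dots> = (\<Sum>i\<in>UNIV. s $ i * ((z $ i)\<^sup>2 * ((p $ i)\<^sup>2 + (q $ i)\<^sup>2)))"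
    by (simp add: power_mult_distrib algebra_simps flip: sum.distrib)
  finally have 2: "P \<bullet> (A *v P) + R \<bullet> (A *v R) + (R \<bullet> (A *v R) + T \<bullet> (A *v T))
      \<le> (\<Sum>i\<in>UNIV. s $ i)"
    by (simp add: z unit)
  have "n\<^sup>2 = 2 * ((z \<bullet> P)\<^sup>2 + (z \<bullet> T)\<^sup>2) - (z \<bullet> P - z \<bullet> T)\<^sup>2"
    unfolding zPT[symmetric] by algebra
  then have "n\<^sup>2 \<le> 2 * ((z \<bullet> P)\<^sup>2 + (z \<bullet> T)\<^sup>2)" by simp
  then have 3: "n\<^sup>2 / 2 \<le> (z \<bullet> P)\<^sup>2 + (z \<bullet> T)\<^sup>2" by simp
  have 4: "p \<bullet> (E *v p) + q \<bullet> (E *v q) \<le> e * n"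
    using quadratic_form_le[OF E, of p] quadratic_form_le[OF E, of q]
    by (simp add: abs_le_iff algebra_simps flip: pq)
  have 5: "P \<bullet> (E *v P) + 2 * (R \<bullet> (E *v R)) + T \<bullet> (E *v T) \<ge> - (e * n)"
    using quadratic_form_le[OF E, of P] quadratic_form_le[OF E, of R] quadratic_form_le[OF E, of T]
    by (simp add: abs_le_iff algebra_simps flip: PRT)
  \<comment> \<open>The noise enters through both 4 and 5, hence the factor 2; the square of
    \<open>z \<bullet> R\<close> is dropped.\<close>
  show ?thesis
    using 1 2 3 4 5 zero_le_power2[of "z \<bullet> R"]
    unfolding A_def signal_plus_noise_quadratic_form by linarith
qed

section \<open>Exact recovery from the critical-point equations\<close>

text \<open>The case after rotation, where \<open>u\<close> carries all the correlation with
  \<open>z\<close>. In the application \<open>d\<close> is \<open>\<gamma> * c\<close> and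
  \<open>l\<close> is the square root of \<open>ln n\<close>.\<close>

lemma aligned_critical_point:
  fixes u v s z :: "real ^ 'n" and E :: "real ^ 'n ^ 'n"
  defines "n \<equiv> real CARD('n)"
  assumes unit: "\<And>i. (u $ i)\<^sup>2 + (v $ i)\<^sup>2 = 1" and z: "\<And>i. (z $ i)\<^sup>2 = 1"
    and E: "\<And>x. norm (E *v x) \<le> d * n * norm x" and Ez: "\<And>i. \<bar>(E *v z) $ i\<bar> \<le> d * n * l"
    and d: "0 \<le> d" "0 \<le> l" "d * (9 + l + 4 * sqrt (d * n)) < 1"
    and s: "\<And>i. s $ i > 0"
    and S: "z \<bullet> u = S" "S > 0" "S\<^sup>2 \<ge> n\<^sup>2 / 2 - 2 * (d * n) * n"
    and u: "S *\<^sub>R z + E *v u = pmul s u" and v: "E *v v = pmul s v"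
  shows "u = z \<and> v = 0"
proof -
  have n: "n \<ge> 1" by (simp add: n_def Suc_leI)
  have dl: "0 \<le> d * l" "0 \<le> d * sqrt (d * n)"
    using d n by simp_all
  have d9: "9 * d + d * l + 4 * (d * sqrt (d * n)) < 1"
    using d(3) by (simp add: algebra_simps)
  then have d1: "d < 1 / 9" using dl by linarith
  \<comment> \<open>The constant is 1/2 - 2/9, from \<open>d < 1 / 9\<close>.\<close>
  have S1: "S\<^sup>2 \<ge> 5 / 18 * n\<^sup>2"
  proof -
    have "2 * (d * n) * n \<le> 2 / 9 * n\<^sup>2"
      using mult_right_mono[of d "1 / 9" "n * n"] d1 by (simp add: power2_eq_square)
    then show ?thesis using S(3) by linarith
  qed
  define D where "D = (norm (u - z))\<^sup>2 + (norm v)\<^sup>2"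
  have uv: "(norm u)\<^sup>2 + (norm v)\<^sup>2 = n"
    by (simp add: norm_vec_power2 unit n_def flip: sum.distrib)
  have zn: "(norm z)\<^sup>2 = n"
    by (simp add: norm_vec_power2 z n_def)
  have "D = (norm u)\<^sup>2 + (norm v)\<^sup>2 + (norm z)\<^sup>2 - 2 * (z \<bullet> u)"
    unfolding D_def power2_norm_eq_inner by (simp add: algebra_simps inner_commute)
  then have D_S: "D = 2 * n - 2 * S" by (simp add: uv zn S)
  have "S\<^sup>2 * D = (\<Sum>i\<in>UNIV. S\<^sup>2 * ((u $ i - z $ i)\<^sup>2 + (v $ i)\<^sup>2))"
    by (simp add: D_def norm_vec_power2 sum_distrib_left flip: sum.distrib)
  also have "\<dots> \<le> (\<Sum>i\<in>UNIV. 4 * (((E *v u) $ i)\<^sup>2 + ((E *v v) $ i)\<^sup>2))"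
  proof (rule sum_mono)
    fix i
    have "s $ i * u $ i = S * z $ i + (E *v u) $ i"
      using arg_cong[OF u, of "\<lambda>x. x $ i"] by simp
    moreover have "s $ i * v $ i = (E *v v) $ i"
      using arg_cong[OF v, of "\<lambda>x. x $ i"] by simp
    ultimately show "S\<^sup>2 * ((u $ i - z $ i)\<^sup>2 + (v $ i)\<^sup>2) \<le> 4 * (((E *v u) $ i)\<^sup>2 + ((E *v v) $ i)\<^sup>2)"
      using normalization_error[OF s S(2) unit z] by blast
  qed
  also have "\<dots> = 4 * ((norm (E *v u))\<^sup>2 + (norm (E *v v))\<^sup>2)"
    by (simp add: norm_vec_power2 sum_distrib_left flip: sum.distrib)
  also have "\<dots> \<le> 4 * ((d * n * norm u)\<^sup>2 + (d * n * norm v)\<^sup>2)"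
    by (intro mult_left_mono add_mono power_mono E) auto
  also have "\<dots> = 4 * (d * n)\<^sup>2 * ((norm u)\<^sup>2 + (norm v)\<^sup>2)"
    by (simp add: power_mult_distrib algebra_simps)
  also have "\<dots> = 4 * (d * n)\<^sup>2 * n" by (simp add: uv)
  finally have "S\<^sup>2 * D \<le> 4 * (d * n)\<^sup>2 * n" .
  moreover have "5 / 18 * n\<^sup>2 * D \<le> S\<^sup>2 * D"
    by (intro mult_right_mono S1) (simp add: D_def)
  ultimately have "n\<^sup>2 * (5 / 18 * D) \<le> n\<^sup>2 * (4 * d\<^sup>2 * n)"
    by (simp add: power_mult_distrib algebra_simps)
  \<comment> \<open>The crude bound on \<open>S\<close> enters here: 72/5 is 4 divided by
    5/18.\<close>
  then have D: "D \<le> 72 / 5 * d\<^sup>2 * n"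
    using n by (simp add: mult_le_cancel_left)
  have d2: "d\<^sup>2 \<le> 1 / 9 * d"
    unfolding power2_eq_square using d d1 by (intro mult_right_mono) auto
  then have d2n: "d\<^sup>2 * n \<le> 1 / 9 * d * n"
    using n by (intro mult_right_mono) auto
  \<comment> \<open>By \<open>D_S\<close>, \<open>n - S\<close> is \<open>D / 2\<close>, hence at
    most \<open>4 / 5 * d * n\<close>.\<close>
  have S2: "S \<ge> n * (1 - d)"
  proof -
    have "0 \<le> d * n" using d n by simp
    with D D_S d2n show ?thesis by (simp add: algebra_simps)
  qed
  have "norm (u - z) \<le> 4 * sqrt (d * n)"
  proof (rule power2_le_imp_le)
    have "(norm (u - z))\<^sup>2 \<le> D" by (simp add: D_def)
    moreover have "0 \<le> d * n" using d n by simp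
    ultimately have "(norm (u - z))\<^sup>2 \<le> 16 * (d * n)" using D d2n by linarith
    then show "(norm (u - z))\<^sup>2 \<le> (4 * sqrt (d * n))\<^sup>2"
      using d n by (simp add: power_mult_distrib)
  qed (use d n in simp)
  then have "d * n * norm (u - z) \<le> d * n * (4 * sqrt (d * n))"
    using d n by (intro mult_left_mono) auto
  then have "norm (E *v (u - z)) \<le> d * n * (4 * sqrt (d * n))"
    using E[of "u - z"] by linarith
  then have Eu: "\<bar>(E *v u) $ i\<bar> \<le> d * n * l + d * n * (4 * sqrt (d * n))" for i
    using Ez[of i] component_le_norm_cart[of "E *v (u - z)" i]
    by (simp add: matrix_vector_mult_diff_distrib)
  \<comment> \<open>Of the \<open>9 * d * n\<close> reserved by the noise condition, one
    \<open>d * n\<close> pays for \<open>n - S\<close> and another for the right-hand side; the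
    other terms cover \<open>E *v u\<close>.\<close>
  have gap: "S - \<bar>(E *v u) $ i\<bar> > d * n" for i
  proof -
    have "n * (9 * d + d * l + 4 * (d * sqrt (d * n))) < n * 1"
      using d9 n by (intro mult_strict_left_mono) auto
    moreover have "0 \<le> d * n" using d n by simp
    ultimately show ?thesis using S2 Eu[of i] by (simp add: algebra_simps)
  qed
  have z1: "\<bar>z $ i\<bar> = 1" for i using z[of i] by (simp add: abs_square_eq_1)
  have su: "s $ i * u $ i = S * z $ i + (E *v u) $ i" for i
    using arg_cong[OF u, of "\<lambda>x. x $ i"] by simp
  have s_gt: "s $ i > d * n" for i
  proof -
    have "\<bar>u $ i\<bar> \<le> 1"
      using unit[of i] zero_le_power2[of "v $ i"] unfolding abs_square_le_1[symmetric] by linarith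
    then have "\<bar>s $ i * u $ i\<bar> \<le> s $ i"
      using s[of i] by (simp add: abs_mult mult_left_le)
    moreover have "\<bar>S * z $ i\<bar> = S" using S(2) z1 by (simp add: abs_mult)
    ultimately show ?thesis using su[of i] gap[of i] by linarith
  qed
  have v0: "v = 0"
  proof (rule ccontr)
    assume "v \<noteq> 0"
    then obtain k where k: "v $ k \<noteq> 0" by (auto simp: vec_eq_iff)
    have "(d * n)\<^sup>2 * (norm v)\<^sup>2 = (\<Sum>i\<in>UNIV. (d * n)\<^sup>2 * (v $ i)\<^sup>2)"
      by (simp add: norm_vec_power2 sum_distrib_left)
    also have "\<dots> < (\<Sum>i\<in>UNIV. (s $ i)\<^sup>2 * (v $ i)\<^sup>2)"
    proof (rule sum_strict_mono_ex1)
      have sq: "(d * n)\<^sup>2 < (s $ i)\<^sup>2" for i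
        using s_gt[of i] d n by (intro power_strict_mono) auto
      show "\<forall>i\<in>UNIV. (d * n)\<^sup>2 * (v $ i)\<^sup>2 \<le> (s $ i)\<^sup>2 * (v $ i)\<^sup>2"
        by (intro ballI mult_right_mono less_imp_le[OF sq] zero_le_power2)
      show "\<exists>i\<in>UNIV. (d * n)\<^sup>2 * (v $ i)\<^sup>2 < (s $ i)\<^sup>2 * (v $ i)\<^sup>2"
        using k sq by (intro bexI[of _ k] mult_strict_right_mono) auto
    qed simp
    also have "\<dots> = (norm (E *v v))\<^sup>2"
      by (simp add: v norm_vec_power2 power_mult_distrib)
    also have "\<dots> \<le> (d * n * norm v)\<^sup>2"
      by (intro power_mono E) auto
    finally show False by (simp add: power_mult_distrib)
  qed
  \<comment> \<open>With \<open>v = 0\<close> each entry of \<open>u\<close> is a sign. As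
    \<open>s $ i\<close> is positive and \<open>S\<close> dominates the noise, it is the sign of
    \<open>z $ i\<close>.\<close>
  have "u = z"
  proof (subst vec_eq_iff, rule allI)
    fix i
    have "\<bar>(E *v u) $ i\<bar> < S"
      using gap[of i] d n mult_nonneg_nonneg[of d n] by linarith
    moreover have "z $ i = 1 \<or> z $ i = - 1" using z1[of i] by linarith
    moreover have "u $ i = 1 \<or> u $ i = - 1"
      using unit[of i] by (simp add: v0 power2_eq_1_iff)
    ultimately show "u $ i = z $ i"
      using su[of i] s[of i] by (elim disjE) auto
  qed
  with v0 show ?thesis by simp
qed

text \<open>Rotating the two columns changes neither the Gram matrix nor the multipliers, which
  reduces the claim to \<open>aligned_critical_point\<close>.\<close>

lemma critical_point_gram:
  fixes Q :: "real ^ 2 ^ 'n" and z :: "real ^ 'n" and E :: "real ^ 'n ^ 'n"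
  defines "A \<equiv> outer_prod z + E" and "n \<equiv> real CARD('n)"
  assumes crit: "second_order_critical A Q" and z: "\<And>i. (z $ i)\<^sup>2 = 1"
    and E: "\<And>x. norm (E *v x) \<le> d * n * norm x" and Ez: "\<And>i. \<bar>(E *v z) $ i\<bar> \<le> d * n * l"
    and E_diag: "\<And>i. E $ i $ i = 0"
    and d: "0 \<le> d" "0 \<le> l" "d * (9 + l + 4 * sqrt (d * n)) < 1"
  shows "Q ** transpose Q = outer_prod z"
proof -
  define p where "p = column 1 Q"
  define q where "q = column 2 Q"
  define s where "s = (\<chi> i. (A ** Q ** transpose Q) $ i $ i)"
  have n: "n \<ge> 1" by (simp add: n_def Suc_leI)
  have unit: "(p $ i)\<^sup>2 + (q $ i)\<^sup>2 = 1" for i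
    using crit feasible_columns[of Q i] by (simp add: p_def q_def second_order_critical_def)
  have fo: "A *v p = pmul s p" "A *v q = pmul s q"
    using second_order_critical_first_order[OF crit] by (simp_all add: p_def q_def s_def)
  have so: "pmul p x \<bullet> (A *v pmul p x) + pmul q x \<bullet> (A *v pmul q x)
               \<le> (\<Sum>i\<in>UNIV. s $ i * (x $ i)\<^sup>2)" for x
    using second_order_critical_quadratic_form[OF crit, of x] by (simp add: p_def q_def s_def)
  \<comment> \<open>A coordinate vector isolates one diagonal entry. \<open>A\<close> has unit
    diagonal because \<open>E\<close> has zero diagonal, so \<open>s $ i\<close> is even at least
    1.\<close>
  have s: "s $ i > 0" for i
  proof -
    have ax: "pmul w (axis i 1) = w $ i *\<^sub>R axis i 1" for w :: "real ^ 'n"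
      by (simp add: vec_eq_iff axis_def)
    have Aii: "axis i 1 \<bullet> (A *v axis i 1) = 1"
      using z[of i] E_diag[of i]
      by (simp add: inner_axis' matrix_vector_mul_component inner_axis A_def outer_prod_def power2_eq_square)
    have "(p $ i)\<^sup>2 + (q $ i)\<^sup>2 \<le> (\<Sum>j\<in>UNIV. s $ j * (axis i 1 $ j)\<^sup>2)"
      using so[of "axis i 1"]
      by (simp add: ax matrix_vector_mult_scaleR Aii power2_eq_square)
    also have "\<dots> = (\<Sum>j\<in>UNIV. if j = i then s $ j else 0)"
      by (intro sum.cong) (auto simp: axis_def)
    finally show ?thesis by (simp add: unit)
  qed
  define g where "g = z \<bullet> p"
  define h where "h = z \<bullet> q"
  define S where "S = sqrt (g\<^sup>2 + h\<^sup>2)"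
  have S2: "S\<^sup>2 = g\<^sup>2 + h\<^sup>2" by (simp add: S_def)
  have lower: "S\<^sup>2 \<ge> n\<^sup>2 / 2 - 2 * (d * n) * n"
    using correlation_lower_bound[OF unit z E[unfolded n_def] fo[unfolded A_def] so[unfolded A_def]]
    by (simp add: S2 g_def h_def n_def)
  have "0 \<le> d * (l + 4 * sqrt (d * n))" using d n by simp
  then have "d < 1 / 9" using d(3) by (simp add: algebra_simps)
  then have "2 * (d * n) * n < 1 / 2 * (n * n)" using n by simp
  then have "S\<^sup>2 > 0" using lower by (simp add: power2_eq_square)
  then have S: "S > 0" by (simp add: S_def)
  \<comment> \<open>The rotation takes \<open>(g, h) / S\<close> as first direction, so that
    \<open>z \<bullet> u\<close> is \<open>S\<close> and \<open>z \<bullet> v\<close>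
    vanishes.\<close>
  define u where "u = (1 / S) *\<^sub>R (g *\<^sub>R p + h *\<^sub>R q)"
  define v where "v = (1 / S) *\<^sub>R (g *\<^sub>R q - h *\<^sub>R p)"
  have rot: "S\<^sup>2 * (u $ i * u $ j + v $ i * v $ j) = S\<^sup>2 * (p $ i * p $ j + q $ i * q $ j)" for i j
  proof -
    have "S\<^sup>2 * (u $ i * u $ j + v $ i * v $ j) = (S * u $ i) * (S * u $ j) + (S * v $ i) * (S * v $ j)"
      by (simp add: power2_eq_square algebra_simps)
    also have "\<dots> = (g * p $ i + h * q $ i) * (g * p $ j + h * q $ j)
        + (g * q $ i - h * p $ i) * (g * q $ j - h * p $ j)"
      using S by (simp add: u_def v_def)
    finally show ?thesis unfolding S2 by algebra
  qed
  then have rot: "u $ i * u $ j + v $ i * v $ j = p $ i * p $ j + q $ i * q $ j" for i j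
    using S by simp
  have Ew: "E *v p = pmul s p - g *\<^sub>R z" "E *v q = pmul s q - h *\<^sub>R z"
    using fo unfolding A_def signal_plus_noise_mult_vec
    by (simp_all add: g_def h_def algebra_simps)
  have "u = z \<and> v = 0"
  proof (rule aligned_critical_point[of u v z E d l s S])
    show "(u $ i)\<^sup>2 + (v $ i)\<^sup>2 = 1" for i
      using rot[of i i] unit[of i] by (simp add: power2_eq_square)
    have gh: "(g * g + h * h) / S = S"
      using S S2 by (simp add: power2_eq_square divide_eq_eq)
    then show "z \<bullet> u = S"
      by (simp add: u_def inner_add_right flip: g_def h_def)
    have "S * S * z $ i = (g * g + h * h) * z $ i" for i
      using S2 by (simp add: power2_eq_square)
    then have "S * (S * z $ i) = g * (g * z $ i) + h * (h * z $ i)" for i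
      by (simp add: algebra_simps)
    then show "S *\<^sub>R z + E *v u = pmul s u"
      using S
      by (simp add: u_def matrix_vector_mult_scaleR matrix_vector_right_distrib Ew vec_eq_iff)
        (simp add: field_simps)
    show "E *v v = pmul s v"
      by (simp add: v_def matrix_vector_mult_scaleR matrix_vector_mult_diff_distrib Ew vec_eq_iff
         field_simps)
  qed (use z E Ez d s S lower in \<open>simp_all add: n_def\<close>)
  then show ?thesis
    using rot by (simp add: vec_eq_iff gram_nth outer_prod_def flip: p_def q_def)
qed

section \<open>Global optimality by duality\<close>

text \<open>The dual certificate is \<open>diag w - A\<close> with \<open>w = z \<circ> Az\<close>. It annihilates \<open>z\<close>, and on the
  orthogonal complement of \<open>z\<close> the diagonal dominates the noise.\<close>
lemma dual_certificate:
  fixes x z :: "real ^ 'n" and E :: "real ^ 'n ^ 'n"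
  defines "n \<equiv> real CARD('n)"
  assumes z: "\<And>i. (z $ i)\<^sup>2 = 1" and sym: "transpose E = E"
    and E: "\<And>x. norm (E *v x) \<le> e * norm x" and Ez: "\<And>i. \<bar>(E *v z) $ i\<bar> \<le> b"
    and eb: "e + b \<le> n"
  shows "x \<bullet> ((outer_prod z + E) *v x) \<le> (\<Sum>i\<in>UNIV. (n + z $ i * (E *v z) $ i) * (x $ i)\<^sup>2)"
proof -
  have n: "n > 0" by (simp add: n_def)
  have zz: "z \<bullet> z = n" by (simp add: inner_vec_def n_def z flip: power2_eq_square)
  have adj: "a \<bullet> (E *v y) = y \<bullet> (E *v a)" for a y
    by (metis dot_lmul_matrix inner_commute sym vector_transpose_matrix)
  define t where "t = (z \<bullet> x) / n"
  define y where "y = x - t *\<^sub>R z"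
  have x: "x = y + t *\<^sub>R z" by (simp add: y_def)
  have zy: "z \<bullet> y = 0" using n by (simp add: y_def t_def inner_diff_right zz)
  have "(\<Sum>i\<in>UNIV. (n + z $ i * (E *v z) $ i) * (x $ i)\<^sup>2)
      = (\<Sum>i\<in>UNIV. (n + z $ i * (E *v z) $ i) * (y $ i)\<^sup>2) + 2 * t * (y \<bullet> (n *\<^sub>R z + E *v z))
        + t\<^sup>2 * (z \<bullet> (n *\<^sub>R z + E *v z))"
  proof -
    \<comment> \<open>The diagonal part of the certificate and \<open>outer_prod z + E\<close> send
      \<open>z\<close> to the same vector, so both expansions share all terms involving
      \<open>t\<close> and only the \<open>y\<close> parts remain to be compared.\<close>
    have wz: "(n + z $ i * (E *v z) $ i) * z $ i = n * z $ i + (E *v z) $ i" for i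
    proof -
      have "(n + z $ i * (E *v z) $ i) * z $ i = n * z $ i + (z $ i)\<^sup>2 * (E *v z) $ i"
        by algebra
      then show ?thesis by (simp add: z)
    qed
    have "(n + z $ i * (E *v z) $ i) * (x $ i)\<^sup>2
        = (n + z $ i * (E *v z) $ i) * (y $ i)\<^sup>2 + 2 * t * (y $ i * (n * z $ i + (E *v z) $ i))
          + t\<^sup>2 * (z $ i * (n * z $ i + (E *v z) $ i))" for i
      unfolding wz[symmetric] by (simp add: x power2_eq_square algebra_simps)
    then show ?thesis
      by (simp add: sum.distrib sum_distrib_left inner_vec_def)
  qed
  moreover have "x \<bullet> ((outer_prod z + E) *v x)
      = y \<bullet> (E *v y) + 2 * t * (y \<bullet> (n *\<^sub>R z + E *v z)) + t\<^sup>2 * (z \<bullet> (n *\<^sub>R z + E *v z))"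
    unfolding x signal_plus_noise_quadratic_form
    using zy adj[of y z]
    by (simp add: matrix_vector_right_distrib matrix_vector_mult_scaleR inner_add_left inner_add_right
        zz inner_commute[of y z] algebra_simps power2_eq_square)
  moreover have "y \<bullet> (E *v y) \<le> (\<Sum>i\<in>UNIV. (n + z $ i * (E *v z) $ i) * (y $ i)\<^sup>2)"
  proof -
    have "y \<bullet> (E *v y) \<le> e * (norm y)\<^sup>2" using quadratic_form_le[OF E, of y] by simp
    also have "\<dots> = (\<Sum>i\<in>UNIV. e * (y $ i)\<^sup>2)" by (simp add: norm_vec_power2 sum_distrib_left)
    also have "\<dots> \<le> (\<Sum>i\<in>UNIV. (n + z $ i * (E *v z) $ i) * (y $ i)\<^sup>2)"
    proof (intro sum_mono mult_right_mono)
      fix i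
      have "\<bar>z $ i\<bar> = 1" using z[of i] by (simp add: abs_square_eq_1)
      then have "\<bar>z $ i * (E *v z) $ i\<bar> \<le> b" using Ez[of i] by (simp add: abs_mult)
      then show "e \<le> n + z $ i * (E *v z) $ i" using eb by linarith
    qed auto
    finally show ?thesis .
  qed
  ultimately show ?thesis by linarith
qed

text \<open>Weak duality: summed over both columns, the certificate bounds the objective by a
  constant since rows have unit length. \<open>Q\<close> attains it, as the objective depends only
  on the Gram matrix.\<close>

lemma gram_outer_prod_global_optimum:
  fixes Q :: "real ^ 2 ^ 'n" and z :: "real ^ 'n" and E :: "real ^ 'n ^ 'n"
  assumes z: "\<And>i. (z $ i)\<^sup>2 = 1" and sym: "transpose E = E"
    and E: "\<And>x. norm (E *v x) \<le> e * norm x" and Ez: "\<And>i. \<bar>(E *v z) $ i\<bar> \<le> b"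
    and eb: "e + b \<le> real CARD('n)"
    and feas: "feasible Q" and gram: "Q ** transpose Q = outer_prod z"
  shows "global_optimum (outer_prod z + E) Q"
proof -
  define w where "w i = real CARD('n) + z $ i * (E *v z) $ i" for i
  have upper: "objective (outer_prod z + E) P \<le> sum w UNIV" if "feasible P" for P
  proof -
    have "objective (outer_prod z + E) P
        \<le> (\<Sum>i\<in>UNIV. w i * (column 1 P $ i)\<^sup>2) + (\<Sum>i\<in>UNIV. w i * (column 2 P $ i)\<^sup>2)"
      unfolding objective_columns w_def
      by (intro add_mono dual_certificate[OF z sym E Ez eb])
    also have "\<dots> = (\<Sum>i\<in>UNIV. w i * ((column 1 P $ i)\<^sup>2 + (column 2 P $ i)\<^sup>2))"
      by (simp add: distrib_left sum.distrib)
    finally show ?thesis using feasible_columns[OF that] by simp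
  qed
  have "objective (outer_prod z + E) Q = z \<bullet> ((outer_prod z + E) *v z)"
  proof -
    have "objective B Q = (\<Sum>i\<in>UNIV. \<Sum>j\<in>UNIV. B $ i $ j * (Q ** transpose Q) $ i $ j)" for B
      unfolding objective_columns gram_nth
      by (simp add: inner_vec_def matrix_vector_mult_def sum_distrib_left algebra_simps
          flip: sum.distrib)
    then show ?thesis
      by (simp add: gram) (simp add: outer_prod_def inner_vec_def matrix_vector_mult_def sum_distrib_left mult_ac)
  qed
  also have "\<dots> = sum w UNIV"
  proof -
    have "z \<bullet> z = real CARD('n)" by (simp add: inner_vec_def z flip: power2_eq_square)
    then show ?thesis
      unfolding signal_plus_noise_quadratic_form
      by (simp add: w_def sum.distrib power2_eq_square) (simp add: inner_vec_def)
  qed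
  finally show ?thesis
    using upper feas by (simp add: global_optimum_def is_arg_max_linorder)
qed

text \<open>One factor \<open>sqrt n\<close> from the noise scale and one from the bounds on
  \<open>\<Delta>\<close> multiply to \<open>n\<close>, which brings the hypotheses into the form
  used above.\<close>

lemma noise_condition_recovery:
  fixes z :: "real ^ 'n"
  assumes model: "signal_plus_noise z \<Delta> \<gamma> c A" and noise: "noise_condition CARD('n) \<gamma> c"
  shows "critical_points_recover A z"
proof -
  define n where "n = real CARD('n)"
  define d where "d = \<gamma> * c"
  define l where "l = sqrt (ln n)"
  define E where "E = (c * sqrt n) *\<^sub>R \<Delta>"
  have n: "n \<ge> 1" by (simp add: n_def Suc_leI)
  have d0: "0 \<le> d" and l0: "0 \<le> l" and c0: "0 \<le> c"
    using model n by (simp_all add: d_def l_def signal_plus_noise_def)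
  have A: "A = outer_prod z + E" and sym: "transpose E = E" and diag: "E $ i $ i = 0" for i
    using model by (simp_all add: signal_plus_noise_def Let_def E_def n_def transpose_scalar)
  have z: "(z $ i)\<^sup>2 = 1" for i
    using model by (auto simp: signal_plus_noise_def power2_eq_1_iff)
  have Ev: "E *v x = (c * sqrt n) *\<^sub>R (\<Delta> *v x)" for x
    by (simp add: E_def scaleR_matrix_vector_assoc)
  have bound: "norm (E *v x) \<le> d * n * norm x" for x
  proof -
    have "norm (E *v x) = c * sqrt n * norm (\<Delta> *v x)"
      using c0 n by (simp add: Ev)
    also have "\<dots> \<le> c * sqrt n * (onorm ((*v) \<Delta>) * norm x)"
      using c0 n by (intro mult_left_mono onorm) auto
    also have "\<dots> \<le> c * sqrt n * ((\<gamma> * sqrt n) * norm x)"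
      using model c0 n
      by (intro mult_left_mono mult_right_mono) (auto simp: signal_plus_noise_def n_def)
    also have "\<dots> = d * (sqrt n * sqrt n) * norm x" by (simp add: d_def)
    finally show ?thesis using n by simp
  qed
  have Ez: "\<bar>(E *v z) $ i\<bar> \<le> d * n * l" for i
  proof -
    have "\<bar>(E *v z) $ i\<bar> = c * sqrt n * \<bar>(\<Delta> *v z) $ i\<bar>"
      using c0 n by (simp add: Ev abs_mult)
    also have "\<dots> \<le> c * sqrt n * infnorm (\<Delta> *v z)"
      using c0 n by (intro mult_left_mono component_le_infnorm_cart) auto
    also have "\<dots> \<le> c * sqrt n * (\<gamma> * sqrt (n * ln n))"
      using model c0 n by (intro mult_left_mono) (auto simp: signal_plus_noise_def n_def)
    also have "\<dots> = d * (sqrt n * sqrt n) * l" by (simp add: d_def l_def real_sqrt_mult)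
    finally show ?thesis using n by simp
  qed
  have cond: "d * (9 + l + 4 * sqrt (d * n)) < 1"
  proof -
    have "0 < 9 + l + 4 * sqrt (d * n)" using d0 l0 n by (intro add_pos_nonneg) auto
    then show ?thesis
      using noise by (simp add: noise_condition_def d_def l_def n_def pos_less_divide_eq)
  qed
  \<comment> \<open>The dual certificate asks for \<open>d * (1 + l) \<le> 1\<close>, which follows
    from the stronger noise condition.\<close>
  have eb: "d * n + d * n * l \<le> real CARD('n)"
  proof -
    have "0 \<le> d * (8 + 4 * sqrt (d * n))" using d0 n by simp
    with cond have "d * (1 + l) \<le> 1" by (simp add: algebra_simps)
    then have "n * (d * (1 + l)) \<le> n * 1" using n by (intro mult_left_mono) auto
    then show ?thesis by (simp add: algebra_simps n_def)
  qed
  show ?thesis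
    unfolding critical_points_recover_def
  proof (intro allI impI)
    fix Q :: "real ^ 2 ^ 'n"
    assume crit: "second_order_critical A Q"
    have gram: "Q ** transpose Q = outer_prod z"
      using critical_point_gram[of z E Q d l] crit z bound Ez diag d0 l0 cond
      by (simp add: A n_def)
    moreover have "feasible Q" using crit by (simp add: second_order_critical_def)
    ultimately show "global_optimum A Q \<and> rank Q = 1 \<and> Q ** transpose Q = outer_prod z"
      using gram_outer_prod_global_optimum[OF z sym bound Ez eb] rank_gram_outer_prod[OF z]
      by (simp add: A)
  qed
qed

theorem theorem15:
  "(\<forall>(z :: real ^ 'n) \<Delta> \<gamma> c A.
      signal_plus_noise z \<Delta> \<gamma> c A \<longrightarrow> noise_condition CARD('n) \<gamma> c \<longrightarrow>
      critical_points_recover A z) \<and>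
   (\<exists>k>0.
      (\<forall>n\<ge>1. \<forall>\<gamma>\<ge>0. \<forall>c\<ge>0.
         \<gamma> * c \<le> k * real n powr (-1/3) \<longrightarrow> noise_condition n \<gamma> c) \<and>
      (\<forall>(z :: real ^ 'n) \<Delta> \<gamma> c A.
         signal_plus_noise z \<Delta> \<gamma> c A \<longrightarrow>
         \<gamma> * c \<le> k * real CARD('n) powr (-1/3) \<longrightarrow>
         critical_points_recover A z))"
proof (intro conjI exI[of _ "1 / 16"] allI impI)
  fix z :: "real ^ 'n" and \<Delta> \<gamma> c A
  assume model: "signal_plus_noise z \<Delta> \<gamma> c A" and "\<gamma> * c \<le> 1 / 16 * real CARD('n) powr (-1/3)"
  then have "noise_condition CARD('n) \<gamma> c"
    by (intro noise_condition_of_le_powr) (auto simp: signal_plus_noise_def Suc_leI)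
  then show "critical_points_recover A z"
    by (rule noise_condition_recovery[OF model])
qed (auto intro: noise_condition_recovery noise_condition_of_le_powr)

end
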